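(* Let $n\ge 1$ be an integer and let $f_n$ be the friendship graph with $n$ triangles. Then $\mathrm{mpd}(f_n)=\infty$.
   Context: The friendship graph $f_n$ has a center $u$ and further vertices $v_1,\dots,v_{2n}$, and is the union of the $n$ triangles $\{u,v_{2i-1},v_{2i}\}$, $1\le i\le n$, which pairwise share only the vertex $u$. $d(u,v)$ denotes the shortest-path distance. Let $G$ be a connected graph and let $\Pi=\{S_1,\dots,S_t\}$ be a partition of $V(G)$ into nonempty parts. For $v\in V(G)$ put $d(v,S_i)=\min\{d(v,x):x\in S_i\}$. The multiset partition representation of $v$ with respect to $\Pi$ is the multiset $r_{mp}(v\mid\Pi)=\{d(v,S_1),\dots,d(v,S_t)\}$ (order ignored, multiplicities kept). $\Pi$ is a resolving multiset partition if $r_{mp}(u\mid\Pi)\ne r_{mp}(v\mid\Pi)$ for all distinct $u,v\in V(G)$. The multiset partition dimension $\mathrm{mpd}(G)$ is the minimum number $t$ of parts of a resolving multiset partition of $G$, and $\mathrm{mpd}(G)=\infty$ if none exists. *)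

theory Defs
  imports
    "Graph_Theory.Graph_Theory"
    "HOL-Library.Multiset"
    "HOL-Library.Disjoint_Sets"
    "HOL-Library.Extended_Nat"
begin

text \<open>
  Finite simple graphs are rendered as in \<^locale>\<open>pair_graph\<close>: an undirected edge is a
  pair of opposite arcs. The shortest-path distance is the library's shortest-path cost with
  every arc of weight 1.
\<close>

definition gdist :: "'a pair_pre_digraph \<Rightarrow> 'a \<Rightarrow> 'a \<Rightarrow> ereal" where
  "gdist G u v = wf_digraph.\<mu> (with_proj G) (\<lambda>_. 1) u v"

text \<open>The use of \<^const>\<open>Min\<close> and \<^const>\<open>mset_set\<close> below presupposes a finite vertex set.\<close>

definition gdist_set :: "'a pair_pre_digraph \<Rightarrow> 'a \<Rightarrow> 'a set \<Rightarrow> ereal" where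
  "gdist_set G v S = Min (gdist G v ` S)"

definition multiset_partition_rep ::
    "'a pair_pre_digraph \<Rightarrow> 'a set set \<Rightarrow> 'a \<Rightarrow> ereal multiset" where
  "multiset_partition_rep G P v = image_mset (gdist_set G v) (mset_set P)"

definition resolving_multiset_partition :: "'a pair_pre_digraph \<Rightarrow> 'a set set \<Rightarrow> bool" where
  "resolving_multiset_partition G P \<longleftrightarrow>
     partition_on (pverts G) P \<and>
     (\<forall>u\<in>pverts G. \<forall>v\<in>pverts G. u \<noteq> v \<longrightarrow>
        multiset_partition_rep G P u \<noteq> multiset_partition_rep G P v)"

text \<open>The infimum of the empty set in \<^typ>\<open>enat\<close> is \<open>\<infinity>\<close>; that of a nonempty set is its minimum.\<close>

definition mpd :: "'a pair_pre_digraph \<Rightarrow> enat" where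
  "mpd G = Inf {enat (card P) |P. resolving_multiset_partition G P}"

text \<open>The center is the vertex 0, and \<open>v\<^sub>i\<close> is the vertex \<open>i\<close> for \<open>1 \<le> i \<le> 2 * n\<close>.\<close>

definition friendship_graph :: "nat \<Rightarrow> nat pair_pre_digraph" where
  "friendship_graph n =
     \<lparr> pverts = {0..2 * n},
       parcs = (\<Union>i\<in>{1..n}. {(x, y). x \<in> {0, 2 * i - 1, 2 * i} \<and> y \<in> {0, 2 * i - 1, 2 * i} \<and> x \<noteq> y}) \<rparr>"

lemma pair_graph_friendship_graph: "pair_graph (friendship_graph n)"
proof
  have sub: "parcs (friendship_graph n) \<subseteq> {0..2 * n} \<times> {0..2 * n}"
    by (auto simp: friendship_graph_def)
  then show "finite (parcs (friendship_graph n))"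
    by (rule finite_subset) simp
  show "finite (pverts (friendship_graph n))"
    by (simp add: friendship_graph_def)
  show "fst e \<in> pverts (friendship_graph n)" "snd e \<in> pverts (friendship_graph n)"
    if "e \<in> parcs (friendship_graph n)" for e
    using sub that by (auto simp: friendship_graph_def)
  show "fst e \<noteq> snd e" if "e \<in> parcs (friendship_graph n)" for e
    using that by (auto simp: friendship_graph_def)
  show "symmetric (with_proj (friendship_graph n))"
    by (auto simp: symmetric_def friendship_graph_def intro!: symI)
qed

lemma connected_friendship_graph: "connected (with_proj (friendship_graph n))"
proof -
  interpret pair_graph "friendship_graph n" by (rule pair_graph_friendship_graph)
  have arc: "(0, v) \<in> parcs (friendship_graph n)"
    if "v \<in> pverts (friendship_graph n)" "v \<noteq> 0" for v
  proof -
    have "(v + 1) div 2 \<in> {1..n}" "v = 2 * ((v + 1) div 2) - 1 \<or> v = 2 * ((v + 1) div 2)"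
      using that by (auto simp: friendship_graph_def)
    then show ?thesis
      using that unfolding friendship_graph_def by auto
  qed
  have zero: "0 \<in> pverts (friendship_graph n)" by (simp add: friendship_graph_def)
  have from0: "0 \<rightarrow>\<^sup>*\<^bsub>with_proj (friendship_graph n)\<^esub> v" if "v \<in> pverts (friendship_graph n)" for v
    using arc[OF that] zero by (cases "v = 0") auto
  have "u \<rightarrow>\<^sup>*\<^bsub>with_proj (friendship_graph n)\<^esub> v"
    if "u \<in> pverts (friendship_graph n)" "v \<in> pverts (friendship_graph n)" for u v
    using symmetric_reachable[OF sym_arcs from0[OF that(1)]] from0[OF that(2)] by (rule reachable_trans)
  then have "strongly_connected (with_proj (friendship_graph n))"
    using zero by (auto simp: strongly_connected_def)
  then show ?thesis
    by (simp add: connected_def strongly_connected_def reachable_mk_symmetric_eq[OF sym_arcs])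
qed

end

theory Submission
  imports Defs
begin

text \<open>The vertices 1 and 2 are adjacent and have the same further neighbours, so they have the same
  distance to every other vertex. Hence every part containing both or neither of them is equally far
  from both, and if they lie in different parts then these two parts contribute the distances 0 and 1
  to both representations. So no partition of a graph with two such vertices is resolving.\<close>

locale adjacent_twins = pair_graph G for G :: "'a pair_pre_digraph" +
  fixes a b :: 'a
  assumes adj: "(a, b) \<in> parcs G"
    and twin: "\<And>c. c \<noteq> a \<Longrightarrow> c \<noteq> b \<Longrightarrow> (a, c) \<in> parcs G \<longleftrightarrow> (b, c) \<in> parcs G"
begin

text \<open>Arcs come in opposite pairs, so the roles of the twins can be exchanged and every
  one-sided estimate below also holds in its mirrored form.\<close>

lemma adjacent_twins_commute: "adjacent_twins G b a"
  using adj twin by unfold_locales (auto intro: arcs_symmetric)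

lemma twins_in_verts: "a \<in> pverts G" "b \<in> pverts G"
  using adj by (auto dest: in_arcsD1 in_arcsD2)

lemma twins_neq: "a \<noteq> b"
  using no_loops[of "(a, b)"] adj by auto

text \<open>With unit weights the cost of a walk is its length. Upper bounds on distances thus come
  from one walk, lower bounds from a bound on all walks.\<close>

lemma gdist_eq_INF: "gdist G u v = (INF p\<in>{p. awalk u p v}. ereal (real (length p)))"
  by (simp add: gdist_def \<mu>_def awalk_cost_def sum_list_triv)

lemma gdist_le_of_walk: "awalk u p v \<Longrightarrow> gdist G u v \<le> ereal (real (length p))"
  unfolding gdist_eq_INF by (auto intro: INF_lower)

lemma gdist_nonneg: "0 \<le> gdist G u v"
  unfolding gdist_eq_INF by (rule INF_greatest) simp

lemma gdist_self: "u \<in> pverts G \<Longrightarrow> gdist G u u = 0"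
  using gdist_le_of_walk[of u "[]" u] gdist_nonneg[of u u] by (simp add: awalk_Nil_iff zero_ereal_def)

lemma one_le_gdist: "u \<noteq> v \<Longrightarrow> 1 \<le> gdist G u v"
  unfolding gdist_eq_INF
  by (rule INF_greatest) (auto simp: one_ereal_def Suc_le_eq awalk_Nil_iff)

lemma gdist_twins: "gdist G a b = 1"
  using gdist_le_of_walk[of a "[(a, b)]" b] one_le_gdist[OF twins_neq] adj twins_in_verts
  by (simp add: awalk_simps one_ereal_def)

text \<open>A walk from \<open>b\<close> either continues through \<open>a\<close>, or its first arc can be moved to start in \<open>a\<close>.\<close>

lemma gdist_twin_le:
  assumes "x \<noteq> b"
  shows "gdist G a x \<le> gdist G b x"
  unfolding gdist_eq_INF[of b]
proof (rule INF_greatest)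
  fix p assume "p \<in> {p. awalk b p x}"
  then have p: "awalk b p x" by simp
  \<comment> \<open>The empty walk from \<open>b\<close> ends in \<open>b\<close>, so
    \<open>x \<noteq> b\<close> forces a first arc.\<close>
  then obtain e es where e: "p = e # es" "e \<in> parcs G" "fst e = b" "awalk (snd e) es x"
    using assms by (cases p) (auto simp: awalk_Nil_iff awalk_Cons_iff)
  have "\<exists>q. awalk a q x \<and> length q \<le> length p"
  proof (cases "snd e = a")
    case True
    then show ?thesis using e by auto
  next
    case False
    \<comment> \<open>Without loops \<open>snd e\<close> also differs from \<open>b\<close>, so it
      is a common neighbour of the twins.\<close>
    then have "(a, snd e) \<in> parcs G"
      using e twin[of "snd e"] no_loops by (metis prod.collapse)
    then have "awalk a ((a, snd e) # es) x"
      using e by (simp add: awalk_Cons_iff)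
    then show ?thesis using e by (intro exI[of _ "(a, snd e) # es"]) simp
  qed
  then show "gdist G a x \<le> ereal (real (length p))"
    by (meson gdist_le_of_walk ereal_less_eq(3) of_nat_le_iff order_trans)
qed

lemma gdist_twin_eq: "x \<noteq> a \<Longrightarrow> x \<noteq> b \<Longrightarrow> gdist G a x = gdist G b x"
  by (simp add: antisym gdist_twin_le
      adjacent_twins.gdist_twin_le[OF adjacent_twins_commute])

lemma gdist_set_self:
  assumes "S \<subseteq> pverts G" "u \<in> S"
  shows "gdist_set G u S = 0"
  unfolding gdist_set_def
proof (rule Min_eqI)
  show "finite (gdist G u ` S)"
    using assms finite_subset[OF _ pair_finite_verts] by simp
  show "0 \<in> gdist G u ` S"
    using assms gdist_self[of u] by (metis image_eqI subsetD)
qed (auto simp: gdist_nonneg)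

text \<open>The value 1 is attained at \<open>b\<close>, and every vertex of \<open>S\<close>
  differs from \<open>a\<close>, hence is at distance at least 1.\<close>

lemma gdist_set_twin:
  assumes "S \<subseteq> pverts G" "a \<notin> S" "b \<in> S"
  shows "gdist_set G a S = 1"
  unfolding gdist_set_def
proof (rule Min_eqI)
  show "finite (gdist G a ` S)"
    using assms finite_subset[OF _ pair_finite_verts] by simp
  show "1 \<in> gdist G a ` S"
    using assms gdist_twins by (metis image_eqI)
qed (use assms in \<open>auto intro!: one_le_gdist\<close>)

lemma gdist_set_twin_eq:
  assumes "a \<notin> S" "b \<notin> S"
  shows "gdist_set G a S = gdist_set G b S"
proof -
  have "gdist G a ` S = gdist G b ` S"
    using assms by (intro image_cong) (auto intro: gdist_twin_eq)
  then show ?thesis by (simp add: gdist_set_def)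
qed

lemma multiset_partition_rep_twins:
  assumes P: "partition_on (pverts G) P"
  shows "multiset_partition_rep G P a = multiset_partition_rep G P b"
proof -
  have fin: "finite P"
    using P by (rule finite_elements[rotated]) simp
  have sub: "S \<subseteq> pverts G" if "S \<in> P" for S
    using P that by (auto simp: partition_on_def)
  obtain A B where A: "A \<in> P" "a \<in> A" and B: "B \<in> P" "b \<in> B"
    using P twins_in_verts by (metis partition_on_def UnionE)
  have part: "S = T" if "S \<in> P" "T \<in> P" "x \<in> S" "x \<in> T" for S T x
    using P that by (auto simp: partition_on_def disjoint_def)
  \<comment> \<open>By disjointness \<open>A\<close> is the only part containing \<open>a\<close>
    and \<open>B\<close> the only one containing \<open>b\<close>.\<close>
  have other: "gdist_set G a S = gdist_set G b S" if "S \<in> P" "S \<noteq> A" "S \<noteq> B" for S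
    using that A B part by (intro gdist_set_twin_eq) blast+
  show ?thesis
  proof (cases "A = B")
    case True
    have "gdist_set G a S = gdist_set G b S" if "S \<in> P" for S
      using that other A B True sub by (cases "S = A") (simp_all add: gdist_set_self)
    then show ?thesis
      using fin unfolding multiset_partition_rep_def by (intro image_mset_cong) auto
  next
    case False
    then have notin: "b \<notin> A" "a \<notin> B"
      using A B part by blast+
    \<comment> \<open>Splitting off both parts leaves a remainder on which the two distance
      functions agree.\<close>
    have "P = insert A (insert B (P - {A, B}))"
      using A B by auto
    then have "mset_set P = add_mset A (add_mset B (mset_set (P - {A, B})))"
      using fin False
      by (metis Diff_iff finite.insertI finite_Diff insertCI insertE mset_set.insert)
    moreover have "image_mset (gdist_set G a) (mset_set (P - {A, B}))
        = image_mset (gdist_set G b) (mset_set (P - {A, B}))"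
      using fin other by (intro image_mset_cong) auto
    ultimately show ?thesis
      using A B notin sub
      by (simp add: multiset_partition_rep_def gdist_set_self gdist_set_twin
          adjacent_twins.gdist_set_twin[OF adjacent_twins_commute])
  qed
qed

theorem mpd_eq_infinity: "mpd G = \<infinity>"
proof -
  have "\<not> resolving_multiset_partition G P" for P
    using multiset_partition_rep_twins[of P] twins_in_verts twins_neq
    unfolding resolving_multiset_partition_def by blast
  \<comment> \<open>The infimum is taken over the empty set, where it is \<infinity> in
    \<open>enat\<close>.\<close>
  then show ?thesis
    by (simp add: mpd_def Inf_enat_def)
qed

end

lemma friendship_graph_arc_from_first_triangle:
  assumes "n \<ge> 1" "v \<in> {1, 2}" "c \<notin> {1, 2}"
  shows "(v, c) \<in> parcs (friendship_graph n) \<longleftrightarrow> c = 0"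
proof
  assume "(v, c) \<in> parcs (friendship_graph n)"
  then obtain i where i: "v \<in> {0, 2 * i - 1, 2 * i}" "c \<in> {0, 2 * i - 1, 2 * i}"
    by (auto simp only: friendship_graph_def pair_pre_digraph.simps UN_iff mem_Collect_eq case_prod_conv)
  \<comment> \<open>The index is determined by \<open>v\<close>: for \<open>i = 0\<close> truncated
    subtraction leaves only the vertex 0, and for \<open>i \<ge> 2\<close> the nonzero entries
    exceed 2.\<close>
  then have "i = 1"
    using assms(2) unfolding insert_iff empty_iff by presburger
  then show "c = 0"
    using i assms(3) by simp
next
  assume "c = 0"
  \<comment> \<open>The form \<open>2 * 1 - 1\<close> is kept so that the set is literally the
    member of the union at index 1.\<close>
  have "(v, 0) \<in> {(x, y). x \<in> {0, 2 * 1 - 1, 2 * 1} \<and> y \<in> {0, 2 * 1 - 1, 2 * 1} \<and> x \<noteq> y}"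
    using assms(2) by auto
  with \<open>c = 0\<close> assms(1) show "(v, c) \<in> parcs (friendship_graph n)"
    unfolding friendship_graph_def pair_pre_digraph.simps by (intro UN_I[of 1]) auto
qed

theorem theorem4p3:
  fixes n :: nat
  assumes "n \<ge> 1"
  shows "mpd (friendship_graph n) = \<infinity>"
proof -
  \<comment> \<open>The twins are the two outer vertices of the first triangle, which exists because
    \<open>n \<ge> 1\<close>; their only further neighbour is the center 0.\<close>
  interpret adjacent_twins "friendship_graph n" 1 2
  proof (intro adjacent_twins.intro adjacent_twins_axioms.intro)
    show "pair_graph (friendship_graph n)"
      by (rule pair_graph_friendship_graph)
    show "(1, 2) \<in> parcs (friendship_graph n)"
      using assms by (force simp: friendship_graph_def)
    fix c :: nat assume "c \<noteq> 1" "c \<noteq> 2"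
    then show "(1, c) \<in> parcs (friendship_graph n) \<longleftrightarrow> (2, c) \<in> parcs (friendship_graph n)"
      using assms by (simp add: friendship_graph_arc_from_first_triangle)
  qed
  show ?thesis
    by (rule mpd_eq_infinity)
qed

end
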